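(* For all $a \in (0, \tfrac12)$ and $x \in (0,1)$ we have $$L_a(x) < {}_3F_2\left( a, a, a+\tfrac12; \tfrac12, a+1 ; x^{\frac1a} \right) < R_a(x),$$ where $$L_a(x) = \frac12\,\left(1 + \frac{4a^2}{1+2a}\,x^{\frac1{2a}}\right) + \frac{1+\frac{2a}{1+2a}\log(1+x^{\frac1{2a}})}{2(1+x^{\frac1{2a}})^{2a}},$$ $$R_a(x) = \frac{\pi_{1/(2a)}}4 + \frac{1+2a \log(1+x^{\frac1{2a}})}{2(1+x^{\frac1{2a}})^{2a}},$$ and $\pi_p = \dfrac{2\pi}{p\, \sin(\pi/p)}$ for $p>1$.
   Context: The generalized hypergeometric (Clausen) function is ${}_3F_2(a,b,c;d,e;z)=\sum_{n\ge0}\frac{(a,n)(b,n)(c,n)}{(d,n)(e,n)}\frac{z^n}{n!}$ for $|z|<1$, where $(a,n)=a(a+1)\cdots(a+n-1)$ (with $(a,0)=1$) is the rising factorial. *)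

theory Defs
  imports "HOL-Analysis.Analysis" "HOL-Real_Asymp.Real_Asymp"
begin

text \<open>
  The series represents Clausen's function for \<open>\<bar>z\<bar> < 1\<close> and \<open>d\<close>, \<open>e\<close> not non-positive
  integers; no analytic continuation is intended outside the unit interval.
\<close>

definition hyp_3F2 :: "real \<Rightarrow> real \<Rightarrow> real \<Rightarrow> real \<Rightarrow> real \<Rightarrow> real \<Rightarrow> real" where
  "hyp_3F2 a b c d e z =
     (\<Sum>n. (pochhammer a n * pochhammer b n * pochhammer c n) /
           (pochhammer d n * pochhammer e n) * (z ^ n / fact n))"

lemma hyp_3F2_eq_eval_fps: "hyp_3F2 a b c d e z = eval_fps (fps_hypergeo [a, b, c] [d, e] 1) z"
  by (simp add: hyp_3F2_def eval_fps_def)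

lemma summable_hyp_3F2:
  fixes a b c d e z :: real
  assumes "\<bar>z\<bar> < 1"
  shows "summable (\<lambda>n. (pochhammer a n * pochhammer b n * pochhammer c n) /
           (pochhammer d n * pochhammer e n) * (z ^ n / fact n))" (is "summable ?t")
proof -
  define r where
    "r n = (a + real n) * (b + real n) * (c + real n) /
             ((d + real n) * (e + real n) * (1 + real n))" for n
  have step: "?t (Suc n) = (r n * z) * ?t n" for n
    by (simp add: r_def pochhammer_Suc mult_ac)
  have "r \<longlonglongrightarrow> 1"
    unfolding r_def by real_asymp
  then have lim: "(\<lambda>n. \<bar>r n * z\<bar>) \<longlonglongrightarrow> \<bar>1 * z\<bar>"
    by (intro tendsto_intros)
  define q where "q = (1 + \<bar>z\<bar>) / 2"
  have q: "\<bar>1 * z\<bar> < q" "q < 1"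
    using assms by (auto simp: q_def)
  obtain N where N: "\<And>n. n \<ge> N \<Longrightarrow> \<bar>r n * z\<bar> < q"
    using order_tendstoD(2)[OF lim q(1)] by (auto simp: eventually_sequentially)
  show ?thesis
  proof (rule summable_ratio_test[OF q(2)])
    fix n assume "N \<le> n"
    then show "norm (?t (Suc n)) \<le> q * norm (?t n)"
      unfolding step real_norm_def abs_mult[of "r n * z"]
      by (intro mult_right_mono less_imp_le[OF N]) auto
  qed
qed

text \<open>The generalized \<open>\<pi>\<close> is meaningful for \<open>p > 1\<close>.\<close>

definition gen_pi :: "real \<Rightarrow> real" where
  "gen_pi p = 2 * pi / (p * sin (pi / p))"

definition L_bound :: "real \<Rightarrow> real \<Rightarrow> real" where
  "L_bound a x =
     1 / 2 * (1 + 4 * a\<^sup>2 / (1 + 2 * a) * x powr (1 / (2 * a))) +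
     (1 + 2 * a / (1 + 2 * a) * ln (1 + x powr (1 / (2 * a)))) /
       (2 * (1 + x powr (1 / (2 * a))) powr (2 * a))"

definition R_bound :: "real \<Rightarrow> real \<Rightarrow> real" where
  "R_bound a x =
     gen_pi (1 / (2 * a)) / 4 +
     (1 + 2 * a * ln (1 + x powr (1 / (2 * a)))) /
       (2 * (1 + x powr (1 / (2 * a))) powr (2 * a))"

end

theory Submission
  imports Defs
begin

text \<open>
  Put \<open>t = 2 a\<close> and \<open>y = x powr (1 / t)\<close>, so that \<open>0 < t < 1\<close>, \<open>0 < y < 1\<close>, and the argument of the
  Clausen function is \<open>y\<^sup>2\<close>. By the duplication formulas for \<open>pochhammer\<close> and \<open>fact\<close>, its series is the
  part with even exponents of
  \<open>G(z) = \<^sub>2F\<^sub>1(t, t; t+1; z) = (\<Sum>m. (t)\<^sub>m / m! * t / (t + m) * z\<^sup>m) = t * \<integral>\<^sub>0\<^sup>1 u\<^bsup>t-1\<^esup> (1 - u z)\<^bsup>-t\<^esup> du\<close>,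
  that is, \<open>(G(y) + G(-y)) / 2\<close>. Both bounds split in the same way, and the two halves are estimated
  separately.

  \<^item> \<open>G(y)\<close> has positive coefficients. It therefore exceeds the sum of its first two terms,
    \<open>1 + t\<^sup>2 / (1 + t) * y\<close>, and stays below \<open>G(1) = t * B(t, 1 - t) = \<pi> t / sin (\<pi> t)\<close>, which is half
    of the generalized \<open>\<pi>\<close> for the parameter \<open>1 / t\<close>.

  \<^item> For \<open>G(-y)\<close>, substituting \<open>s = u y\<close> in the integral gives
    \<open>y\<^sup>t G(-y) = t * \<integral>\<^sub>0\<^sup>y s\<^bsup>t-1\<^esup> (1 + s)\<^bsup>-t\<^esup> ds\<close>.
    The bounds have the form \<open>B(y) = (1 + c * ln (1 + y)) / (1 + y)\<^sup>t\<close> with \<open>c = t\<close> and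
    \<open>c = t / (1 + t)\<close>. Both \<open>y\<^sup>t G(-y)\<close> and \<open>y\<^sup>t B(y)\<close> vanish at \<open>0\<close>, and the quotient of the derivative
    of the latter by that of the former is \<open>1 + (c * ln (1 + y) - y * (1 - c / t)) / (1 + y)\<close>.
    For \<open>c = t\<close> the correction is positive; for \<open>c = t / (1 + t)\<close> we have \<open>1 - c / t = c\<close>, and it is
    negative because \<open>ln (1 + y) < y\<close>.
\<close>

section \<open>The series of \<open>\<^sub>2F\<^sub>1(t, t; t+1; z)\<close>\<close>

definition binom_coeff :: "real \<Rightarrow> nat \<Rightarrow> real" where
  "binom_coeff t m = pochhammer t m / fact m"

definition inc_beta_coeff :: "real \<Rightarrow> nat \<Rightarrow> real" where
  "inc_beta_coeff t m = binom_coeff t m * (t / (t + real m))"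

text \<open>
  This is \<open>t * z\<^bsup>-t\<^esup>\<close> times the incomplete beta integral \<open>\<integral>\<^sub>0\<^sup>z s\<^bsup>t-1\<^esup> (1 - s)\<^bsup>-t\<^esup> ds\<close>; the power of \<open>z\<close> is
  divided out so that negative arguments make sense.
\<close>

definition inc_beta :: "real \<Rightarrow> real \<Rightarrow> real" where
  "inc_beta t z = (\<Sum>m. inc_beta_coeff t m * z ^ m)"

lemma binom_coeff_pos: "t > 0 \<Longrightarrow> binom_coeff t m > 0"
  by (simp add: binom_coeff_def pochhammer_pos)

lemma inc_beta_coeff_pos: "t > 0 \<Longrightarrow> inc_beta_coeff t m > 0"
  by (simp add: inc_beta_coeff_def binom_coeff_pos add_pos_nonneg)

lemma inc_beta_coeff_le: "t > 0 \<Longrightarrow> inc_beta_coeff t m \<le> binom_coeff t m"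
  using binom_coeff_pos[of t m]
  by (auto simp: inc_beta_coeff_def field_simps intro!: mult_left_mono)

lemma inc_beta_coeff_ode: "t > 0 \<Longrightarrow> (t + real m) * inc_beta_coeff t m = t * binom_coeff t m"
  by (simp add: inc_beta_coeff_def add_pos_nonneg field_simps)

lemma binom_coeff_sums:
  assumes "\<bar>z\<bar> < 1"
  shows "(\<lambda>m. binom_coeff t m * z ^ m) sums (1 - z) powr (- t)"
proof -
  have "(\<lambda>m. (-t gchoose m) * (- z) ^ m) sums (1 + - z) powr (- t)"
    by (rule gen_binomial_real) (use assms in simp)
  also have "(\<lambda>m. (-t gchoose m) * (- z) ^ m) = (\<lambda>m. binom_coeff t m * z ^ m)"
    by (simp add: fun_eq_iff gbinomial_pochhammer binom_coeff_def flip: power_mult_distrib)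
  finally show ?thesis by simp
qed

lemma summable_inc_beta:
  assumes "t > 0" "\<bar>z\<bar> < 1"
  shows "summable (\<lambda>m. inc_beta_coeff t m * z ^ m)"
proof (rule summable_comparison_test')
  show "summable (\<lambda>m. binom_coeff t m * \<bar>z\<bar> ^ m)"
    using binom_coeff_sums[of "\<bar>z\<bar>" t] assms by (auto simp: sums_iff)
  show "norm (inc_beta_coeff t m * z ^ m) \<le> binom_coeff t m * \<bar>z\<bar> ^ m" for m
    using inc_beta_coeff_pos[of t m] inc_beta_coeff_le[of t m] assms
    by (auto simp: abs_mult power_abs intro!: mult_right_mono)
qed

lemma inc_beta_sums:
  "t > 0 \<Longrightarrow> \<bar>z\<bar> < 1 \<Longrightarrow> (\<lambda>m. inc_beta_coeff t m * z ^ m) sums inc_beta t z"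
  unfolding inc_beta_def by (intro summable_sums summable_inc_beta)

text \<open>
  Pairing each numerator parameter \<open>a\<close>, \<open>a + 1/2\<close> with the denominator parameters \<open>1/2\<close>, \<open>1\<close> gives
  the even binomial coefficients by duplication, and \<open>(a)\<^sub>n / (a+1)\<^sub>n\<close> telescopes to \<open>a / (a + n)\<close>.
\<close>

lemma hyp_3F2_coeff_eq:
  fixes a :: real
  assumes "a > 0"
  shows "(pochhammer a n * pochhammer a n * pochhammer (a + 1 / 2) n) /
           (pochhammer (1 / 2) n * pochhammer (a + 1) n) / fact n = inc_beta_coeff (2 * a) (2 * n)"
proof -
  have pos: "pochhammer a n > 0" "pochhammer (a + 1) n > 0" "pochhammer (1 / 2 :: real) n > 0"
    using assms by (auto intro!: pochhammer_pos)
  have "a * pochhammer (a + 1) n = pochhammer a n * (a + real n)"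
    by (metis pochhammer_Suc pochhammer_rec)
  hence "pochhammer a n / pochhammer (a + 1) n = a / (a + real n)"
    using pos assms by (simp add: field_simps add_pos_nonneg)
  also have "a / (a + real n) = 2 * a / (2 * a + real (2 * n))"
    using assms by (simp add: field_simps)
  finally have *: "pochhammer a n / pochhammer (a + 1) n = 2 * a / (2 * a + real (2 * n))" .
  have "binom_coeff (2 * a) (2 * n)
          = pochhammer a n * pochhammer (a + 1 / 2) n / (pochhammer (1 / 2) n * fact n)"
    unfolding binom_coeff_def pochhammer_double fact_double by simp
  hence "inc_beta_coeff (2 * a) (2 * n)
      = pochhammer a n * pochhammer (a + 1 / 2) n / (pochhammer (1 / 2) n * fact n) *
          (pochhammer a n / pochhammer (a + 1) n)"
    unfolding inc_beta_coeff_def * by simp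
  thus ?thesis by (simp add: mult_ac)
qed

lemma hyp_3F2_eq_even_part:
  assumes "a > 0" "\<bar>y\<bar> < 1"
  shows "hyp_3F2 a a (a + 1 / 2) (1 / 2) (a + 1) (y\<^sup>2)
           = (inc_beta (2 * a) y + inc_beta (2 * a) (- y)) / 2"
proof -
  let ?c = "inc_beta_coeff (2 * a)"
  let ?f = "\<lambda>m. (?c m * y ^ m + ?c m * (- y) ^ m) / 2"
  have "?f sums ((inc_beta (2 * a) y + inc_beta (2 * a) (- y)) / 2)"
    by (intro sums_divide sums_add inc_beta_sums) (use assms in auto)
  moreover have "?f m = 0" if "m \<notin> range (\<lambda>n. 2 * n)" for m
  proof -
    have "odd m" using that by (auto elim!: evenE)
    thus ?thesis by simp
  qed
  ultimately have "(\<lambda>n. ?f (2 * n)) sums ((inc_beta (2 * a) y + inc_beta (2 * a) (- y)) / 2)"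
    by (subst sums_mono_reindex) (auto simp: strict_mono_def)
  also have "(\<lambda>n. ?f (2 * n)) = (\<lambda>n. (pochhammer a n * pochhammer a n * pochhammer (a + 1 / 2) n) /
           (pochhammer (1 / 2) n * pochhammer (a + 1) n) * ((y\<^sup>2) ^ n / fact n))"
  proof
    fix n
    have "?f (2 * n) = ?c (2 * n) * (y\<^sup>2) ^ n"
      by (simp add: power_mult)
    thus "?f (2 * n) = (pochhammer a n * pochhammer a n * pochhammer (a + 1 / 2) n) /
           (pochhammer (1 / 2) n * pochhammer (a + 1) n) * ((y\<^sup>2) ^ n / fact n)"
      unfolding hyp_3F2_coeff_eq[OF assms(1), symmetric] by simp
  qed
  finally show ?thesis
    unfolding hyp_3F2_def by (simp add: sums_iff)
qed

section \<open>Positive argument\<close>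

lemma inc_beta_gt_linear:
  assumes "t > 0" "0 < y" "y < 1"
  shows "1 + t\<^sup>2 / (1 + t) * y < inc_beta t y"
proof -
  have "(\<Sum>m<2. inc_beta_coeff t m * y ^ m) < inc_beta t y"
    unfolding inc_beta_def
    by (rule sum_less_suminf[OF summable_inc_beta]) (use assms inc_beta_coeff_pos in auto)
  also have "(\<Sum>m<2. inc_beta_coeff t m * y ^ m) = 1 + t\<^sup>2 / (1 + t) * y"
    using assms by (simp add: numeral_2_eq_2 inc_beta_coeff_def binom_coeff_def add.commute)
  finally show ?thesis .
qed

lemma Beta_reflection_real:
  fixes t :: real
  shows "Beta t (1 - t) = pi / sin (pi * t)"
proof -
  have "complex_of_real (Gamma t * Gamma (1 - t)) = of_real (pi / sin (pi * t))"
    using Gamma_reflection_complex[of "of_real t"] Gamma_complex_of_real[of "1 - t"]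
    by (simp add: Gamma_complex_of_real flip: sin_of_real)
  hence "Gamma t * Gamma (1 - t) = pi / sin (pi * t)"
    by (simp only: of_real_eq_iff)
  thus ?thesis by (simp add: Beta_def)
qed

text \<open>
  The sum of the coefficients is the beta integral \<open>t * \<integral>\<^sub>0\<^sup>1 u\<^bsup>t-1\<^esup> (1 - u)\<^bsup>-t\<^esup> du\<close>. Only an upper bound
  is needed, and for that it suffices to integrate partial sums of the binomial series, which lie
  below \<open>(1 - u)\<^bsup>-t\<^esup>\<close>; no interchange of limit and integral occurs.
\<close>

lemma sum_inc_beta_coeff_le:
  assumes "0 < t" "t < 1"
  shows "(\<Sum>m<N. inc_beta_coeff t m) \<le> pi * t / sin (pi * t)"
proof -
  have "((\<lambda>u. \<Sum>m<N. t * binom_coeff t m * u powr (t - 1 + real m)) has_integral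
          (\<Sum>m<N. t * binom_coeff t m * (1 powr (t - 1 + real m + 1) / (t - 1 + real m + 1)))) {0..1}"
    by (intro has_integral_sum has_integral_mult_right has_integral_powr_from_0)
       (use assms in auto)
  also have "(\<Sum>m<N. t * binom_coeff t m * (1 powr (t - 1 + real m + 1) / (t - 1 + real m + 1)))
               = (\<Sum>m<N. inc_beta_coeff t m)"
    by (simp add: inc_beta_coeff_def mult_ac)
  \<comment> \<open>The endpoints are dropped because \<open>0 powr (- t) = 0\<close>, so the bound below would fail at \<open>u = 1\<close>.\<close>
  finally have S: "((\<lambda>u. \<Sum>m<N. t * binom_coeff t m * u powr (t - 1 + real m)) has_integral
          (\<Sum>m<N. inc_beta_coeff t m)) {0<..<1}"
    by (simp add: has_integral_Icc_iff_Ioo)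
  have B: "((\<lambda>u. t * (u powr (t - 1) * (1 - u) powr (- t))) has_integral t * Beta t (1 - t)) {0<..<1}"
    using has_integral_mult_right[OF has_integral_Beta_real[of t "1 - t"], of t] assms
    by (simp add: has_integral_Icc_iff_Ioo)
  have "(\<Sum>m<N. inc_beta_coeff t m) \<le> t * Beta t (1 - t)"
  proof (rule has_integral_le[OF S B])
    fix u :: real assume u: "u \<in> {0<..<1}"
    have "(\<Sum>m<N. binom_coeff t m * u ^ m) \<le> (1 - u) powr (- t)"
      using sum_le_suminf[of "\<lambda>m. binom_coeff t m * u ^ m" "{..<N}"] binom_coeff_sums[of u t]
        u less_imp_le[OF binom_coeff_pos[OF assms(1)]] by (simp add: sums_iff)
    hence "t * (u powr (t - 1) * (\<Sum>m<N. binom_coeff t m * u ^ m))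
             \<le> t * (u powr (t - 1) * (1 - u) powr (- t))"
      using assms by (intro mult_left_mono) auto
    also have "t * (u powr (t - 1) * (\<Sum>m<N. binom_coeff t m * u ^ m))
                 = (\<Sum>m<N. t * binom_coeff t m * u powr (t - 1 + real m))"
      using u by (simp add: sum_distrib_left powr_add powr_realpow mult_ac)
    finally show "(\<Sum>m<N. t * binom_coeff t m * u powr (t - 1 + real m))
                    \<le> t * (u powr (t - 1) * (1 - u) powr (- t))" .
  qed
  thus ?thesis by (simp add: Beta_reflection_real mult_ac)
qed

lemma inc_beta_less:
  assumes "0 < t" "t < 1" "0 < y" "y < 1"
  shows "inc_beta t y < pi * t / sin (pi * t)"
proof -
  let ?c = "inc_beta_coeff t"
  note pos = inc_beta_coeff_pos[OF assms(1)]
  have smc: "summable ?c"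
    by (rule summableI_nonneg_bounded[OF less_imp_le[OF pos] sum_inc_beta_coeff_le[OF assms(1,2)]])
  have smy: "summable (\<lambda>m. ?c m * y ^ m)"
    by (rule summable_inc_beta) (use assms in auto)
  have "0 < (\<Sum>m. ?c m - ?c m * y ^ m)"
  proof (rule suminf_pos2[where i = 1])
    show "summable (\<lambda>m. ?c m - ?c m * y ^ m)"
      by (intro summable_diff smc smy)
    show "0 \<le> ?c m - ?c m * y ^ m" for m
      using pos[of m] assms by (simp add: mult_le_cancel_left1 power_le_one)
    show "0 < ?c 1 - ?c 1 * y ^ 1"
      using pos[of 1] assms by simp
  qed
  hence "inc_beta t y < suminf ?c"
    unfolding inc_beta_def by (simp add: suminf_diff[OF smc smy, symmetric])
  also have "suminf ?c \<le> pi * t / sin (pi * t)"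
    by (rule suminf_le_const[OF smc sum_inc_beta_coeff_le[OF assms(1,2)]])
  finally show ?thesis .
qed

section \<open>Negative argument\<close>

text \<open>
  With \<open>G = inc_beta t\<close>, the recurrence \<open>inc_beta_coeff_ode\<close> is, coefficient by coefficient, the
  differential equation
  \<open>z G'(z) + t G(z) = t (1 - z)\<^bsup>-t\<^esup>\<close>.
\<close>

lemma inc_beta_has_derivative:
  assumes "t > 0" "\<bar>z\<bar> < 1"
  obtains D where "(inc_beta t has_real_derivative D) (at z)"
    and "z * D + t * inc_beta t z = t * (1 - z) powr (- t)"
proof -
  let ?c = "inc_beta_coeff t"
  define K where "K = (\<bar>z\<bar> + 1) / 2"
  have K: "\<bar>z\<bar> < K" "K < 1" using assms by (auto simp: K_def)
  have smK: "summable (\<lambda>m. ?c m * K ^ m)"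
    by (rule summable_inc_beta) (use assms K in auto)
  define D where "D = (\<Sum>m. diffs ?c m * z ^ m)"
  have "((\<lambda>z. \<Sum>m. ?c m * z ^ m) has_real_derivative D) (at z)"
    unfolding D_def by (rule termdiffs_strong[OF smK]) (use K in auto)
  hence deriv: "(inc_beta t has_real_derivative D) (at z)"
    unfolding inc_beta_def[abs_def] .
  have "summable (\<lambda>m. diffs ?c m * z ^ m)"
    by (rule termdiff_converges[where K = K])
       (use K assms in \<open>auto intro!: summable_inc_beta\<close>)
  from diffs_equiv[OF this] have "(\<lambda>m. real m * ?c m * z ^ (m - Suc 0)) sums D"
    unfolding D_def .
  hence "(\<lambda>m. z * (real m * ?c m * z ^ (m - Suc 0)) + t * (?c m * z ^ m)) sums
           (z * D + t * inc_beta t z)"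
    by (intro sums_add sums_mult inc_beta_sums) (use assms in auto)
  also have "(\<lambda>m. z * (real m * ?c m * z ^ (m - Suc 0)) + t * (?c m * z ^ m))
               = (\<lambda>m. t * (binom_coeff t m * z ^ m))"
  proof
    fix m
    have "z * (real m * ?c m * z ^ (m - Suc 0)) + t * (?c m * z ^ m)
            = ((t + real m) * ?c m) * z ^ m"
      by (cases m) (simp_all add: algebra_simps)
    thus "z * (real m * ?c m * z ^ (m - Suc 0)) + t * (?c m * z ^ m)
            = t * (binom_coeff t m * z ^ m)"
      unfolding inc_beta_coeff_ode[OF assms(1)] by simp
  qed
  finally have "z * D + t * inc_beta t z = t * (1 - z) powr (- t)"
    using sums_mult[OF binom_coeff_sums[OF assms(2), of t], of t] by (rule sums_unique2)
  with deriv show ?thesis by (rule that)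
qed

lemma continuous_on_inc_beta:
  assumes "t > 0"
  shows "continuous_on {-1<..<1} (inc_beta t)"
proof (intro continuous_at_imp_continuous_on ballI)
  fix z :: real assume "z \<in> {-1<..<1}"
  hence "\<bar>z\<bar> < 1" by auto
  with assms show "isCont (inc_beta t) z"
    by (rule inc_beta_has_derivative) (rule DERIV_isCont)
qed

definition log_bound :: "real \<Rightarrow> real \<Rightarrow> real \<Rightarrow> real" where
  "log_bound t c y = (1 + c * ln (1 + y)) * (1 + y) powr (- t)"

text \<open>
  The factor \<open>y powr t\<close> is the integrating factor of the differential equation above: it removes
  \<open>inc_beta\<close> itself from the derivative, so that only elementary functions remain to be compared.
\<close>

lemma inc_beta_minus_log_bound_deriv:
  assumes "t > 0" "0 < y" "y < 1"
  shows "((\<lambda>y. y powr t * (inc_beta t (- y) - log_bound t c y)) has_real_derivative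
           t * y powr (t - 1) * (1 + y) powr (- t) * (y * (1 - c / t) - c * ln (1 + y)) / (1 + y)) (at y)"
proof -
  obtain D where D: "(inc_beta t has_real_derivative D) (at (- y))"
    and ode: "- y * D + t * inc_beta t (- y) = t * (1 - - y) powr (- t)"
    using inc_beta_has_derivative[of t "- y"] assms by auto
  have DG: "((\<lambda>y. inc_beta t (- y)) has_real_derivative - D) (at y)"
    using DERIV_chain'[OF DERIV_minus[OF DERIV_ident] D] by simp
  define W where "W = (1 + y) powr (- t)"
  define l where "l = ln (1 + y)"
  have powr: "y powr t = y * y powr (t - 1)" "(1 + y) powr (- t - 1) = W / (1 + y)"
    using assms by (auto simp: powr_diff W_def)
  have DB: "(log_bound t c has_real_derivative
      c / (1 + y) * W - t * (1 + c * l) * (W / (1 + y))) (at y)"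
    unfolding log_bound_def[abs_def] powr(2)[symmetric] W_def l_def
    by (rule derivative_eq_intros refl | use assms in force)+
       (use assms in \<open>simp add: powr_diff\<close>)
  have Dy: "((\<lambda>y. y powr t) has_real_derivative t * y powr (t - 1)) (at y)"
    using assms by (intro has_real_derivative_powr) auto
  have B: "log_bound t c y = (1 + c * l) * W"
    by (simp add: log_bound_def W_def l_def)
  have "t * y powr (t - 1) * (inc_beta t (- y) - log_bound t c y) +
          (- D - (c / (1 + y) * W - t * (1 + c * l) * (W / (1 + y)))) * y powr t
      = y powr (t - 1) * ((t * inc_beta t (- y) - y * D) - t * (1 + c * l) * W
          - y * (c / (1 + y) * W - t * (1 + c * l) * (W / (1 + y))))"
    unfolding powr B by (simp add: algebra_simps)
  also have "t * inc_beta t (- y) - y * D = t * W"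
    using ode by (simp add: W_def)
  also have "t * W - t * (1 + c * l) * W - y * (c / (1 + y) * W - t * (1 + c * l) * (W / (1 + y)))
      = t * W * (y * (1 - c / t) - c * l) / (1 + y)"
    using assms by (simp add: divide_simps) (simp add: algebra_simps)
  finally show ?thesis
    using DERIV_mult[OF Dy DERIV_diff[OF DG DB]] by (simp add: W_def l_def mult_ac)
qed

lemma continuous_on_inc_beta_minus_log_bound:
  assumes "t > 0" "y < 1"
  shows "continuous_on {0..y} (\<lambda>y. y powr t * (inc_beta t (- y) - log_bound t c y))"
  unfolding log_bound_def using assms
  by (intro continuous_intros continuous_on_compose2[OF continuous_on_inc_beta]
        continuous_on_powr') auto

text \<open>
  In the next two lemmas \<open>E 0 = 0\<close> because \<open>0 powr t = 0\<close>, so the sign of \<open>E'\<close> on \<open>(0, y)\<close> is the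
  sign of \<open>inc_beta t (- y) - log_bound t c y\<close>.
\<close>

lemma inc_beta_neg_less:
  assumes "t > 0" "0 < y" "y < 1"
  shows "inc_beta t (- y) < log_bound t t y"
proof -
  define E where "E = (\<lambda>y. y powr t * (inc_beta t (- y) - log_bound t t y))"
  have "E y < E 0"
  proof (rule DERIV_neg_imp_decreasing_open[OF assms(2)])
    show "continuous_on {0..y} E"
      unfolding E_def using assms by (intro continuous_on_inc_beta_minus_log_bound)
    fix s :: real assume s: "0 < s" "s < y"
    have "t * s powr (t - 1) * (1 + s) powr (- t) * (s * (1 - t / t) - t * ln (1 + s)) / (1 + s) < 0"
      using s assms by (auto intro!: divide_neg_pos mult_pos_neg)
    thus "\<exists>D. (E has_real_derivative D) (at s) \<and> D < 0"
      unfolding E_def using inc_beta_minus_log_bound_deriv[of t s t] s assms by auto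
  qed
  thus ?thesis using assms by (simp add: E_def mult_less_0_iff)
qed

lemma inc_beta_neg_greater:
  assumes "t > 0" "0 < y" "y < 1"
  shows "log_bound t (t / (1 + t)) y < inc_beta t (- y)"
proof -
  define c where "c = t / (1 + t)"
  have c: "c > 0" "1 - c / t = c"
    using assms by (simp_all add: c_def divide_simps)
  define E where "E = (\<lambda>y. y powr t * (inc_beta t (- y) - log_bound t c y))"
  have "E 0 < E y"
  proof (rule DERIV_pos_imp_increasing_open[OF assms(2)])
    show "continuous_on {0..y} E"
      unfolding E_def using assms by (intro continuous_on_inc_beta_minus_log_bound)
    fix s :: real assume s: "0 < s" "s < y"
    have "c * ln (1 + s) < s * c"
      using ln_add_one_self_less_self[OF s(1)] c by simp
    hence "t * s powr (t - 1) * (1 + s) powr (- t) * (s * (1 - c / t) - c * ln (1 + s)) / (1 + s) > 0"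
      using s assms unfolding c(2) by (intro divide_pos_pos mult_pos_pos) auto
    thus "\<exists>D. (E has_real_derivative D) (at s) \<and> D > 0"
      unfolding E_def using inc_beta_minus_log_bound_deriv[of t s c] s assms by auto
  qed
  thus ?thesis using assms by (simp add: E_def c_def zero_less_mult_iff)
qed

theorem theorem7:
  fixes a x :: real
  assumes "0 < a" and "a < 1 / 2"
    and "0 < x" and "x < 1"
  shows "L_bound a x < hyp_3F2 a a (a + 1 / 2) (1 / 2) (a + 1) (x powr (1 / a))
    \<and> hyp_3F2 a a (a + 1 / 2) (1 / 2) (a + 1) (x powr (1 / a)) < R_bound a x"
proof -
  define t where "t = 2 * a"
  define y where "y = x powr (1 / t)"
  have t: "0 < t" "t < 1" using assms by (auto simp: t_def)
  have y: "0 < y" "y < 1"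
    using assms t powr_less_mono2[of "1 / t" x 1] by (auto simp: y_def)
  have "x powr (1 / a) = y\<^sup>2"
    using assms by (simp add: y_def t_def powr_powr flip: powr_realpow)
  hence F: "hyp_3F2 a a (a + 1 / 2) (1 / 2) (a + 1) (x powr (1 / a))
              = (inc_beta t y + inc_beta t (- y)) / 2"
    using hyp_3F2_eq_even_part[of a y] assms y by (simp add: t_def)
  have L: "L_bound a x = (1 + t\<^sup>2 / (1 + t) * y + log_bound t (t / (1 + t)) y) / 2"
  proof -
    have "L_bound a x = 1 / 2 * (1 + t\<^sup>2 / (1 + t) * y) +
            (1 + t / (1 + t) * ln (1 + y)) / (2 * (1 + y) powr t)"
      by (simp add: L_bound_def t_def y_def power2_eq_square)
    thus ?thesis
      by (simp add: log_bound_def powr_minus_divide add_divide_distrib mult_ac)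
  qed
  have "gen_pi (1 / t) = 2 * (pi * t / sin (pi * t))"
    by (simp add: gen_pi_def field_simps)
  moreover have "R_bound a x = gen_pi (1 / t) / 4 + (1 + t * ln (1 + y)) / (2 * (1 + y) powr t)"
    by (simp add: R_bound_def t_def y_def)
  ultimately have R: "R_bound a x = (pi * t / sin (pi * t) + log_bound t t y) / 2"
    by (simp add: log_bound_def powr_minus_divide add_divide_distrib mult_ac)
  show ?thesis
    unfolding F L R using t y
    by (intro conjI divide_strict_right_mono add_strict_mono inc_beta_gt_linear inc_beta_less
        inc_beta_neg_less inc_beta_neg_greater) auto
qed

end
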